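(* Let $\gamma\colon\mathfrak N\to\mathbb C$ be a complex moment sequence which has a representing measure $\mu$ such that $\mu(\{0\})>0$. Then the cardinality of $\mathsf{PDE}(\gamma)$ is equal to $\mathfrak c$ (the cardinality of the continuum).
   Context: All measures are positive, and integrands are tacitly assumed to be absolutely integrable wherever integrals appear. Put $\mathfrak N=\{(m,n)\in\mathbb Z^2: m\ge 0,\ n\ge 0\}$ and $\mathfrak N_+=\{(m,n)\in\mathbb Z^2: m+n\ge 0\}$. Convention: $0^0=1$. A sequence $\gamma=\{\gamma_{m,n}\}_{(m,n)\in\mathfrak N}\subset\mathbb C$ is a complex moment sequence if there is a Borel measure $\mu$ on $\mathbb C$ with $\gamma_{m,n}=\int_{\mathbb C} z^m\bar z^n\,d\mu(z)$ for all $(m,n)\in\mathfrak N$; such $\mu$ is called a representing measure for $\gamma$. A sequence $\Gamma=\{\Gamma_{m,n}\}_{(m,n)\in\mathfrak N_+}\subset\mathbb C$ is positive definite on $\mathfrak N_+$ if $\sum_{(m,n),(p,q)\in\mathfrak N_+}\lambda_{m,n}\overline{\lambda_{p,q}}\,\Gamma_{m+q,n+p}\ge 0$ for every finitely supported family $\{\lambda_{m,n}\}_{(m,n)\in\mathfrak N_+}\subset\mathbb C$. $\mathsf{PDE}(\gamma)$ denotes the set of all sequences $\Gamma$ positive definite on $\mathfrak N_+$ with $\Gamma_{m,n}=\gamma_{m,n}$ for all $(m,n)\in\mathfrak N$. *)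

theory Defs
  imports "HOL-Analysis.Analysis" "HOL-Library.Equipollence"
begin

definition N_quadrant :: "(int \<times> int) set"  (\<open>\<NN>\<close>)
  where "\<NN> = {(m, n). m \<ge> 0 \<and> n \<ge> 0}"

definition N_halfplane :: "(int \<times> int) set"  (\<open>\<NN>\<^sub>+\<close>)
  where "\<NN>\<^sub>+ = {(m, n). m + n \<ge> 0}"

text \<open>A sequence on \<open>\<NN>\<close> is a function on all index pairs of which only the values on \<open>\<NN>\<close>
  are ever used.  The integrability condition is explicit because the Bochner integral of a
  non-integrable function is 0; for \<open>m = n = 0\<close> it makes \<open>\<mu>\<close> finite.\<close>

definition representing_measure :: "(int \<times> int \<Rightarrow> complex) \<Rightarrow> complex measure \<Rightarrow> bool"
  where "representing_measure \<gamma> \<mu> \<longleftrightarrow>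
    sets \<mu> = sets borel \<and>
    (\<forall>(m, n)\<in>\<NN>. integrable \<mu> (\<lambda>z. z powi m * cnj z powi n) \<and>
      \<gamma> (m, n) = (\<integral>z. z powi m * cnj z powi n \<partial>\<mu>))"

definition complex_moment_sequence :: "(int \<times> int \<Rightarrow> complex) \<Rightarrow> bool"
  where "complex_moment_sequence \<gamma> \<longleftrightarrow> (\<exists>\<mu>. representing_measure \<gamma> \<mu>)"

text \<open>The sum over a finitely supported family is the sum over its support.\<close>

definition positive_definite_on_halfplane :: "(int \<times> int \<Rightarrow> complex) \<Rightarrow> bool"
  where "positive_definite_on_halfplane \<Gamma> \<longleftrightarrow>
    (\<forall>c :: int \<times> int \<Rightarrow> complex. finite {x \<in> \<NN>\<^sub>+. c x \<noteq> 0} \<longrightarrow>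
      (\<Sum>(m, n)\<in>{x \<in> \<NN>\<^sub>+. c x \<noteq> 0}. \<Sum>(p, q)\<in>{x \<in> \<NN>\<^sub>+. c x \<noteq> 0}.
         c (m, n) * cnj (c (p, q)) * \<Gamma> (m + q, n + p)) \<in> \<real>\<^sub>\<ge>\<^sub>0)"

text \<open>Membership in \<open>extensional \<NN>\<^sub>+\<close> fixes the values off \<open>\<NN>\<^sub>+\<close>, so that each sequence on
  \<open>\<NN>\<^sub>+\<close> is represented by exactly one function and the cardinality is the intended one.\<close>

definition PDE :: "(int \<times> int \<Rightarrow> complex) \<Rightarrow> (int \<times> int \<Rightarrow> complex) set"
  where "PDE \<gamma> = {\<Gamma> \<in> extensional \<NN>\<^sub>+. positive_definite_on_halfplane \<Gamma> \<and>
    (\<forall>(m, n)\<in>\<NN>. \<Gamma> (m, n) = \<gamma> (m, n))}"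

end

theory Submission
  imports Defs
begin

text \<open>
  Pointwise, \<open>(m, n) \<mapsto> z\<^sup>m (cnj z)\<^sup>n\<close> is a character of the semigroup \<open>\<NN>\<close> with the involution
  \<open>(m, n) \<mapsto> (n, m)\<close>, and integrating characters that extend to \<open>\<NN>\<^sub>+\<close> yields positive definite
  extensions of \<open>\<gamma>\<close>.  For \<open>z \<noteq> 0\<close> the character extends by the same formula.  For \<open>z = 0\<close> it is
  the indicator of the origin, and here there is a choice: the only element of \<open>\<NN>\<close> on the
  boundary line \<open>m + n = 0\<close> of \<open>\<NN>\<^sub>+\<close> is the origin, and this line is a group isomorphic to the
  integers, so every character \<open>m \<mapsto> u\<^sup>m\<close> of it with \<open>\<bar>u\<bar> = 1\<close>, extended by 0 to the rest of
  \<open>\<NN>\<^sub>+\<close>, is an extension (lemma \<open>halfplane_character_mult\<close>).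

  Hence every \<open>u\<close> on the unit circle gives a member of \<open>PDE \<gamma>\<close> (lemma
  \<open>extension_in_PDE\<close>), whose value at \<open>(1, -1)\<close> is a constant plus \<open>\<mu>{0} u\<close>
  (lemma \<open>extension_at_antidiagonal\<close>).  As \<open>\<mu>{0} > 0\<close>, different \<open>u\<close> give different extensions,
  so there are at least continuum many.  There are no more, because there are only continuum many
  complex functions on a countable set.
\<close>

section \<open>Characters of the half-plane semigroup\<close>

definition halfplane_character :: "complex \<Rightarrow> complex \<Rightarrow> int \<times> int \<Rightarrow> complex"
  where "halfplane_character u z = (\<lambda>(m, n).
    if z = 0 then (if m + n = 0 then u powi m else 0) else z powi m * cnj z powi n)"

text \<open>For \<open>z = 0\<close> the reason is that degrees \<open>m + n\<close> are nonnegative on \<open>\<NN>\<^sub>+\<close>: two of them add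
  up to 0 only if both are 0, so extending a character of the line \<open>m + n = 0\<close> by 0 keeps it
  multiplicative.  The condition \<open>\<bar>u\<bar> = 1\<close> makes
  \<open>m \<mapsto> u\<^sup>m\<close> compatible with the involution, which acts on this line as negation.\<close>

lemma halfplane_character_mult:
  assumes "cmod u = 1" and "(m, n) \<in> \<NN>\<^sub>+" and "(p, q) \<in> \<NN>\<^sub>+"
  shows "halfplane_character u z (m + q, n + p) =
    halfplane_character u z (m, n) * cnj (halfplane_character u z (p, q))"
proof (cases "z = 0")
  case False
  then show ?thesis
    by (simp add: halfplane_character_def power_int_add)
next
  case True
  have deg: "m + q + (n + p) = 0 \<longleftrightarrow> m + n = 0 \<and> p + q = 0"
    using assms by (auto simp: N_halfplane_def)
  show ?thesis
  proof (cases "m + n = 0 \<and> p + q = 0")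
    case deg0: True
    have "u \<noteq> 0"
      using assms(1) by auto
    have "u * cnj u = 1"
      using assms(1) complex_norm_square[of u] by simp
    then have "inverse u = cnj u"
      by (rule inverse_unique)
    moreover have "q = - p"
      using deg0 by simp
    ultimately have "u powi q = cnj u powi p"
      by (metis power_int_inverse power_int_minus)
    then show ?thesis
      using True deg0 deg \<open>u \<noteq> 0\<close> by (simp add: halfplane_character_def power_int_add)
  next
    case False
    then show ?thesis
      using True deg by (auto simp: halfplane_character_def)
  qed
qed

lemma halfplane_character_eq_monomial:
  assumes "(m, n) \<in> \<NN>"
  shows "halfplane_character u z (m, n) = z powi m * cnj z powi n"
  using assms by (auto simp: halfplane_character_def N_quadrant_def power_int_0_left_if)

lemma norm_halfplane_character_le:
  assumes "cmod u = 1"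
  shows "cmod (halfplane_character u z (m, n)) \<le> cmod (z powi (m + n))"
  using assms
  by (auto simp: halfplane_character_def norm_mult norm_power_int power_int_add)

lemma borel_measurable_halfplane_character [measurable]:
  "(\<lambda>z. halfplane_character u z x) \<in> borel_measurable borel"
proof -
  have [measurable]: "(\<lambda>z. f z powi k) \<in> borel_measurable borel"
    if [measurable]: "f \<in> borel_measurable borel" for f :: "complex \<Rightarrow> complex" and k
    unfolding power_int_def by measurable
  have [measurable]: "cnj \<in> borel_measurable borel"
    by (intro borel_measurable_continuous_onI continuous_intros)
  show ?thesis
    unfolding halfplane_character_def by (cases x) simp
qed

section \<open>Positive definite extensions by integration\<close>

definition extension :: "complex measure \<Rightarrow> complex \<Rightarrow> int \<times> int \<Rightarrow> complex"
  where "extension \<mu> u = (\<lambda>x\<in>\<NN>\<^sub>+. \<integral>z. halfplane_character u z x \<partial>\<mu>)"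

text \<open>The character at \<open>(m, n)\<close> is dominated by the monomial of index \<open>(m + n, 0)\<close>, which lies in
  \<open>\<NN>\<close> even when \<open>(m, n)\<close> does not, so integrability is inherited from the moments of \<open>\<gamma>\<close>.\<close>

lemma integrable_halfplane_character:
  assumes "representing_measure \<gamma> \<mu>" and "cmod u = 1" and "x \<in> \<NN>\<^sub>+"
  shows "integrable \<mu> (\<lambda>z. halfplane_character u z x)"
proof -
  obtain m n where x: "x = (m, n)"
    by fastforce
  have "(m + n, 0) \<in> \<NN>"
    using assms(3) x by (simp add: N_quadrant_def N_halfplane_def)
  then have "integrable \<mu> (\<lambda>z. z powi (m + n))"
    using assms(1) by (fastforce simp: representing_measure_def)
  moreover have "(\<lambda>z. halfplane_character u z x) \<in> borel_measurable \<mu>"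
    using assms(1) by (simp add: representing_measure_def cong: measurable_cong_sets)
  ultimately show ?thesis
    using norm_halfplane_character_le[OF assms(2)]
    by (auto simp: x intro: Bochner_Integration.integrable_bound)
qed

text \<open>By multiplicativity the quadratic form is the integral of
  \<open>\<bar>\<Sum>x. c x * halfplane_character u z x\<bar>\<^sup>2\<close>.\<close>

lemma positive_definite_extension:
  assumes \<mu>: "representing_measure \<gamma> \<mu>" and u: "cmod u = 1"
  shows "positive_definite_on_halfplane (extension \<mu> u)"
  unfolding positive_definite_on_halfplane_def
proof (intro allI impI)
  fix c :: "int \<times> int \<Rightarrow> complex"
  define S where "S = {x \<in> \<NN>\<^sub>+. c x \<noteq> 0}"
  assume "finite {x \<in> \<NN>\<^sub>+. c x \<noteq> 0}"
  then have "finite S"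
    by (simp add: S_def)
  define h where "h = halfplane_character u"
  have add_mem: "(m + q, n + p) \<in> \<NN>\<^sub>+" if "(m, n) \<in> S" "(p, q) \<in> S" for m n p q
    using that by (auto simp: S_def N_halfplane_def)
  have int: "integrable \<mu> (\<lambda>z. c x * cnj (c y) * h z (fst x + snd y, snd x + fst y))"
    if "x \<in> S" "y \<in> S" for x y
    unfolding h_def using that
    by (intro integrable_mult_right integrable_halfplane_character[OF \<mu> u] add_mem) auto
  have square: "(\<Sum>(m, n)\<in>S. \<Sum>(p, q)\<in>S. c (m, n) * cnj (c (p, q)) * h z (m + q, n + p)) =
      of_real ((cmod (\<Sum>x\<in>S. c x * h z x))\<^sup>2)" for z
  proof -
    have "(\<Sum>(m, n)\<in>S. \<Sum>(p, q)\<in>S. c (m, n) * cnj (c (p, q)) * h z (m + q, n + p)) =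
        (\<Sum>x\<in>S. \<Sum>y\<in>S. (c x * h z x) * cnj (c y * h z y))"
      by (intro sum.cong refl)
         (auto intro!: sum.cong simp: S_def h_def halfplane_character_mult[OF u])
    also have "\<dots> = (\<Sum>x\<in>S. c x * h z x) * cnj (\<Sum>x\<in>S. c x * h z x)"
      by (simp add: sum_product)
    finally show ?thesis
      by (simp only: complex_norm_square)
  qed
  have "(\<Sum>(m, n)\<in>S. \<Sum>(p, q)\<in>S. c (m, n) * cnj (c (p, q)) * extension \<mu> u (m + q, n + p)) =
      (\<Sum>(m, n)\<in>S. \<Sum>(p, q)\<in>S. \<integral>z. c (m, n) * cnj (c (p, q)) * h z (m + q, n + p) \<partial>\<mu>)"
    by (intro sum.cong refl) (auto intro!: sum.cong simp: extension_def h_def add_mem)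
  also have "\<dots> = (\<integral>z. (\<Sum>(m, n)\<in>S. \<Sum>(p, q)\<in>S.
      c (m, n) * cnj (c (p, q)) * h z (m + q, n + p)) \<partial>\<mu>)"
    by (simp only: case_prod_beta prod.collapse int Bochner_Integration.integral_sum
        Bochner_Integration.integrable_sum cong: sum.cong)
  also have "\<dots> = of_real (\<integral>z. (cmod (\<Sum>x\<in>S. c x * h z x))\<^sup>2 \<partial>\<mu>)"
    unfolding square by (rule integral_complex_of_real)
  also have "\<dots> \<in> \<real>\<^sub>\<ge>\<^sub>0"
    by simp
  finally show "(\<Sum>(m, n)\<in>{x \<in> \<NN>\<^sub>+. c x \<noteq> 0}. \<Sum>(p, q)\<in>{x \<in> \<NN>\<^sub>+. c x \<noteq> 0}.
      c (m, n) * cnj (c (p, q)) * extension \<mu> u (m + q, n + p)) \<in> \<real>\<^sub>\<ge>\<^sub>0"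
    unfolding S_def .
qed

lemma extension_in_PDE:
  assumes "representing_measure \<gamma> \<mu>" and "cmod u = 1"
  shows "extension \<mu> u \<in> PDE \<gamma>"
proof -
  have "extension \<mu> u (m, n) = \<gamma> (m, n)" if "(m, n) \<in> \<NN>" for m n
  proof -
    have "(m, n) \<in> \<NN>\<^sub>+"
      using that by (auto simp: N_quadrant_def N_halfplane_def)
    then show ?thesis
      using assms(1) that
      by (auto simp: extension_def halfplane_character_eq_monomial representing_measure_def)
  qed
  then show ?thesis
    using positive_definite_extension[OF assms] by (auto simp: PDE_def extension_def simp del: restrict_apply restrict_apply')
qed

lemma extension_at_antidiagonal:
  assumes \<mu>: "representing_measure \<gamma> \<mu>" and u: "cmod u = 1"
  shows "extension \<mu> u (1, -1) = extension \<mu> 1 (1, -1) + (u - 1) * measure \<mu> {0}"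
proof -
  have mem: "(1, -1) \<in> \<NN>\<^sub>+"
    by (simp add: N_halfplane_def)
  have "extension \<mu> u (1, -1) - extension \<mu> 1 (1, -1) =
      (\<integral>z. halfplane_character u z (1, -1) - halfplane_character 1 z (1, -1) \<partial>\<mu>)"
    using integrable_halfplane_character[OF \<mu> _ mem] u mem
    by (simp add: extension_def)
  also have "\<dots> = (\<integral>z. (u - 1) * complex_of_real (indicator {0} z) \<partial>\<mu>)"
    by (intro Bochner_Integration.integral_cong)
       (auto simp: halfplane_character_def indicator_def)
  also have "\<dots> = (u - 1) * measure \<mu> {0}"
  proof -
    have "{0} \<in> sets \<mu>" "space \<mu> = UNIV"
      using \<mu> sets_eq_imp_space_eq[of \<mu> borel] by (auto simp: representing_measure_def)
    then show ?thesis
      by simp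
  qed
  finally show ?thesis
    by (simp add: algebra_simps)
qed

lemma inj_on_extension:
  assumes \<mu>: "representing_measure \<gamma> \<mu>" and pos: "emeasure \<mu> {0} > 0"
  shows "inj_on (extension \<mu>) {u. cmod u = 1}"
proof -
  have "(0, 0) \<in> \<NN>"
    by (simp add: N_quadrant_def)
  then have "integrable \<mu> (\<lambda>_. 1 :: complex)"
    using \<mu> by (fastforce simp: representing_measure_def)
  then have "emeasure \<mu> (space \<mu>) < \<infinity>"
    by (simp add: integrable_iff_bounded)
  then interpret finite_measure \<mu>
    by (intro finite_measureI) auto
  have "measure \<mu> {0} \<noteq> 0"
    using pos by (simp add: emeasure_eq_measure)
  then show ?thesis
    using extension_at_antidiagonal[OF \<mu>] by (intro inj_onI) (metis (mono_tags, lifting)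
        add_left_cancel diff_left_imp_eq mem_Collect_eq mult_right_cancel of_real_eq_0_iff
        diff_add_cancel)
qed

section \<open>Cardinality\<close>

lemma reals_lepoll_unit_circle: "(UNIV :: real set) \<lesssim> {u. cmod u = 1}"
proof -
  have "Im (cis (arctan t)) / Re (cis (arctan t)) = t" for t
    using tan_arctan[of t] by (simp add: tan_def)
  then have "inj (\<lambda>t. cis (arctan t))"
    by (metis injI)
  then show ?thesis
    by (auto simp: lepoll_def)
qed

text \<open>With reals coded as sets of naturals, a complex function on a countable type becomes a
  subset of a countable type by uncurrying; the Boolean index separates real and imaginary
  parts.\<close>

lemma complex_functions_lepoll_reals:
  "(UNIV :: ('a :: countable \<Rightarrow> complex) set) \<lesssim> (UNIV :: real set)"
proof -
  have "(UNIV :: real set) \<lesssim> (UNIV :: nat set set)"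
    using nat_sets_eqpoll_reals by (simp add: eqpoll_imp_lepoll eqpoll_sym)
  then obtain code :: "real \<Rightarrow> nat set" where code: "inj code"
    by (auto simp: lepoll_def)
  define graph :: "('a \<Rightarrow> complex) \<Rightarrow> ('a \<times> bool \<times> nat) set"
    where "graph f = {(x, b, k). k \<in> code (if b then Re (f x) else Im (f x))}" for f
  have "inj graph"
  proof (intro injI ext complex_eqI)
    fix f g x
    assume eq: "graph f = graph g"
    have "code (if b then Re (f x) else Im (f x)) = code (if b then Re (g x) else Im (g x))" for b
      using eq by (auto simp: graph_def set_eq_iff)
    from this[of True] this[of False] show "Re (f x) = Re (g x)" "Im (f x) = Im (g x)"
      using code by (auto dest: injD)
  qed
  moreover have "inj (\<lambda>A :: ('a \<times> bool \<times> nat) set. to_nat ` A)"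
    by (simp add: inj_image_eq_iff inj_def)
  ultimately have "inj (\<lambda>f. to_nat ` graph f)"
    by (auto simp: inj_def)
  then have "(UNIV :: ('a \<Rightarrow> complex) set) \<lesssim> (UNIV :: nat set set)"
    by (auto simp: lepoll_def)
  then show ?thesis
    using nat_sets_eqpoll_reals lepoll_trans2 by blast
qed

theorem proposition5:
  fixes \<gamma> :: "int \<times> int \<Rightarrow> complex" and \<mu> :: "complex measure"
  assumes "complex_moment_sequence \<gamma>"
    and "representing_measure \<gamma> \<mu>"
    and "emeasure \<mu> {0} > 0"
  shows "PDE \<gamma> \<approx> (UNIV :: real set)"
proof (rule lepoll_antisym)
  show "PDE \<gamma> \<lesssim> (UNIV :: real set)"
    using complex_functions_lepoll_reals lepoll_trans subset_imp_lepoll subset_UNIV by metis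
  have "{u. cmod u = 1} \<lesssim> PDE \<gamma>"
    using inj_on_extension[OF assms(2,3)] extension_in_PDE[OF assms(2)]
    unfolding lepoll_def by blast
  then show "(UNIV :: real set) \<lesssim> PDE \<gamma>"
    using reals_lepoll_unit_circle lepoll_trans by blast
qed

end
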